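(* Let $\hbar>0$, $\nu>\hbar/2$, $u=(2\nu/\hbar)^2>1$, $\Sigma_\nu=\nu\mathbb I_2$. Let $G_0^{\rm Frob}$ and $G_2^{\rm Frob}$ be the minima of $F_{\rm Frob}(K)^2=\frac14\operatorname{Tr}(K^{\mathsf T}K)$ over all $K\in\mathfrak{sp}(4,\mathbb R)$ inducing, at the canonical purification $\Gamma_\nu$ of $\Sigma_\nu$, the reduced tangent $X_0=\mathbb I_2$, respectively $X_2=Z$. Then for every $u>1$: (i) $$G_0^{\rm Frob}=g_{{\rm B},\Sigma_\nu}(X_0,X_0)=\frac{1}{\hbar^2(u-1)};$$ (ii) the minimizer $K_\star$ for the target $X_0$ has blocks $A=0$, $B=Z/(2\kappa_\nu)$, $D=0$, and it generates the tangent of the canonical purification family: $$K_\star\Gamma_\nu+\Gamma_\nu K_\star^{\mathsf T}=\frac{\mathrm d}{\mathrm d\nu}\Gamma_\nu;$$ (iii) in the traceless sector, $$G_2^{\rm Frob}=\frac{1}{\hbar^2(3u-1)}<\frac{1}{\hbar^2(u+1)}=g_{{\rm B},\Sigma_\nu}(X_2,X_2).$$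
   Context: Let $\Omega=\begin{pmatrix}0&1\\-1&0\end{pmatrix}$, $Z=\begin{pmatrix}1&0\\0&-1\end{pmatrix}$, $\kappa_\nu=\sqrt{\nu^2-\hbar^2/4}$. The canonical purification of $\Sigma_\nu$ has covariance $\Gamma_\nu=\begin{pmatrix}\nu\mathbb I_2&\kappa_\nu Z\\ \kappa_\nu Z&\nu\mathbb I_2\end{pmatrix}$. With symplectic form $\Omega\oplus\Omega$, every $K\in\mathfrak{sp}(4,\mathbb R)$ has the block form $$K=\begin{pmatrix}A&B\\ \Omega B^{\mathsf T}\Omega&D\end{pmatrix},\qquad A,D\in\mathfrak{sp}(2,\mathbb R)\ (\text{real traceless } 2\times2),\quad B\in\mathbb R^{2\times2}\text{ arbitrary}.$$ $K$ induces the reduced tangent $X$ (a real symmetric $2\times2$ matrix) if the upper-left (system) $2\times2$ block of $K\Gamma_\nu+\Gamma_\nu K^{\mathsf T}$ equals $X$, i.e. $X=\nu(A+A^{\mathsf T})+\kappa_\nu(BZ+ZB^{\mathsf T})$. The covariance Bures metric of faithful centered one-mode Gaussian states is $g_{{\rm B},\Sigma}(X,X)=\tfrac18\operatorname{Tr}(\mathfrak G X)$, where the symmetric matrix $\mathfrak G$ (the symmetric-logarithmic-derivative gain) is the unique solution of $\Sigma\mathfrak G\Sigma+\tfrac{\hbar^2}{4}\Omega\mathfrak G\Omega=X$. (This is $\tfrac14\operatorname{Tr}(\rho L^2)$ with $L$ the symmetric logarithmic derivative.) *)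

theory Defs
  imports "HOL-Analysis.Analysis"
begin

text \<open>
  Two-mode phase space is indexed by the sum type \<^typ>\<open>2 + 2\<close>: the \<^const>\<open>Inl\<close> indices belong to
  the system mode, the \<^const>\<open>Inr\<close> indices to the purifying mode.
\<close>

definition block :: "real^2^2 \<Rightarrow> real^2^2 \<Rightarrow> real^2^2 \<Rightarrow> real^2^2 \<Rightarrow> real^(2+2)^(2+2)" where
  "block A B C D = (\<chi> i j.
     case i of
       Inl i' \<Rightarrow> (case j of Inl j' \<Rightarrow> A $ i' $ j' | Inr j' \<Rightarrow> B $ i' $ j')
     | Inr i' \<Rightarrow> (case j of Inl j' \<Rightarrow> C $ i' $ j' | Inr j' \<Rightarrow> D $ i' $ j'))"

definition block11 :: "real^(2+2)^(2+2) \<Rightarrow> real^2^2" where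
  "block11 M = (\<chi> i j. M $ Inl i $ Inl j)"

definition block12 :: "real^(2+2)^(2+2) \<Rightarrow> real^2^2" where
  "block12 M = (\<chi> i j. M $ Inl i $ Inr j)"

definition block21 :: "real^(2+2)^(2+2) \<Rightarrow> real^2^2" where
  "block21 M = (\<chi> i j. M $ Inr i $ Inl j)"

definition block22 :: "real^(2+2)^(2+2) \<Rightarrow> real^2^2" where
  "block22 M = (\<chi> i j. M $ Inr i $ Inr j)"

definition Omega :: "real^2^2" where
  "Omega = vector [vector [0, 1], vector [-1, 0]]"

definition Zmat :: "real^2^2" where
  "Zmat = vector [vector [1, 0], vector [0, -1]]"

definition Omega2 :: "real^(2+2)^(2+2)" where
  "Omega2 = block Omega 0 0 Omega"

text \<open>
  Symplectic maps act on covariances by \<open>S \<Gamma> S\<^sup>T\<close> and satisfy \<open>S J S\<^sup>T = J\<close>; linearising at the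
  identity gives the Lie algebra condition below (equivalent to \<open>K\<^sup>T J + J K = 0\<close>).
\<close>

definition sp4 :: "(real^(2+2)^(2+2)) set" where
  "sp4 = {K. K ** Omega2 + Omega2 ** transpose K = 0}"

lemma all_two_mode: "(\<forall>x::2+2. P x) \<longleftrightarrow> (\<forall>a. P (Inl a)) \<and> (\<forall>b. P (Inr b))"
  by (metis sum.exhaust)

lemma sum_two_mode:
  fixes f :: "2+2 \<Rightarrow> real"
  shows "(\<Sum>x\<in>UNIV. f x) = (\<Sum>a\<in>UNIV. f (Inl a)) + (\<Sum>b\<in>UNIV. f (Inr b))"
  using sum.Plus[of "UNIV :: 2 set" "UNIV :: 2 set" f] by simp

lemma sp4_iff_blocks:
  "K \<in> sp4 \<longleftrightarrow> trace (block11 K) = 0 \<and> trace (block22 K) = 0 \<and>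
     block21 K = Omega ** transpose (block12 K) ** Omega"
  by (simp add: sp4_def vec_eq_iff matrix_matrix_mult_def Omega2_def block_def transpose_def
      trace_def block11_def block12_def block21_def block22_def Omega_def
      all_two_mode sum_two_mode sum_2 forall_2) argo

definition kappa :: "real \<Rightarrow> real \<Rightarrow> real" where
  "kappa hbar \<nu> = sqrt (\<nu>\<^sup>2 - hbar\<^sup>2 / 4)"

definition Sigma_th :: "real \<Rightarrow> real^2^2" where
  "Sigma_th \<nu> = \<nu> *\<^sub>R mat 1"

definition Gamma_pur :: "real \<Rightarrow> real \<Rightarrow> real^(2+2)^(2+2)" where
  "Gamma_pur hbar \<nu> =
     block (\<nu> *\<^sub>R mat 1) (kappa hbar \<nu> *\<^sub>R Zmat) (kappa hbar \<nu> *\<^sub>R Zmat) (\<nu> *\<^sub>R mat 1)"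

definition induces :: "real \<Rightarrow> real \<Rightarrow> real^2^2 \<Rightarrow> real^(2+2)^(2+2) \<Rightarrow> bool" where
  "induces hbar \<nu> X K \<longleftrightarrow>
     block11 (K ** Gamma_pur hbar \<nu> + Gamma_pur hbar \<nu> ** transpose K) = X"

lemma induces_iff:
  "induces hbar \<nu> X K \<longleftrightarrow>
     X = \<nu> *\<^sub>R (block11 K + transpose (block11 K)) +
       kappa hbar \<nu> *\<^sub>R (block12 K ** Zmat + Zmat ** transpose (block12 K))"
  by (simp add: induces_def vec_eq_iff matrix_matrix_mult_def Gamma_pur_def block_def
      transpose_def block11_def block12_def Zmat_def mat_def
      sum_two_mode sum_2 forall_2) argo

definition F_Frob :: "real^(2+2)^(2+2) \<Rightarrow> real" where
  "F_Frob K = sqrt (1/4 * trace (transpose K ** K))"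

definition frob_minimizer :: "real \<Rightarrow> real \<Rightarrow> real^2^2 \<Rightarrow> real^(2+2)^(2+2) \<Rightarrow> bool" where
  "frob_minimizer hbar \<nu> X =
     is_arg_min (\<lambda>K. (F_Frob K)\<^sup>2) (\<lambda>K. K \<in> sp4 \<and> induces hbar \<nu> X K)"

text \<open>The minimum as a value; it is meaningful only when some \<^const>\<open>frob_minimizer\<close> exists.\<close>

definition G_Frob :: "real \<Rightarrow> real \<Rightarrow> real^2^2 \<Rightarrow> real" where
  "G_Frob hbar \<nu> X = (LEAST g. \<exists>K. K \<in> sp4 \<and> induces hbar \<nu> X K \<and> g = (F_Frob K)\<^sup>2)"

definition sld_gain :: "real \<Rightarrow> real^2^2 \<Rightarrow> real^2^2 \<Rightarrow> real^2^2" where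
  "sld_gain hbar \<Sigma> X = (THE G. transpose G = G \<and>
     \<Sigma> ** G ** \<Sigma> + (hbar\<^sup>2 / 4) *\<^sub>R (Omega ** G ** Omega) = X)"

text \<open>The polarised form of \<open>1/8 Tr(G X)\<close>, with \<open>G\<close> the gain of the first argument.\<close>

definition g_Bures :: "real \<Rightarrow> real^2^2 \<Rightarrow> real^2^2 \<Rightarrow> real^2^2 \<Rightarrow> real" where
  "g_Bures hbar \<Sigma> X Y = 1/8 * trace (sld_gain hbar \<Sigma> X ** Y)"

end

theory Submission
  imports Defs
begin

text \<open>
  On \<open>sp(4,\<real>)\<close> the lower-left block \<open>\<Omega> B\<^sup>T \<Omega>\<close> is a signed rearrangement of the entries of \<open>B\<close>, so the
  Frobenius cost is a diagonal quadratic form in the free entries of \<open>A\<close>, \<open>B\<close> and \<open>D\<close> with the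
  entries of \<open>B\<close> counted twice.  The diagonal of the target fixes \<open>\<nu> a + \<kappa> b\<^sub>1\<^sub>1\<close> and
  \<open>\<nu> a + \<kappa> b\<^sub>2\<^sub>2\<close>.  For the target \<open>I\<close> the entry \<open>a\<close> cancels, leaving the single
  constraint \<open>b\<^sub>1\<^sub>1 - b\<^sub>2\<^sub>2 = 1/\<kappa>\<close>; for the target \<open>Z\<close> one gets \<open>b\<^sub>1\<^sub>1 = b\<^sub>2\<^sub>2\<close>, and Cauchy-Schwarz
  applied to \<open>\<nu> a + \<kappa> b\<^sub>1\<^sub>1 = 1/2\<close> gives the minimum.  Since \<open>\<Omega> I \<Omega> = -I\<close> and
  \<open>\<Omega> Z \<Omega> = Z\<close>, both targets are eigenvectors of the equation for the gain.
\<close>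

section \<open>Block coordinates for the cost and the constraint\<close>

lemma block_blocks [simp]:
  "block11 (block A B C D) = A" "block12 (block A B C D) = B"
  "block21 (block A B C D) = C" "block22 (block A B C D) = D"
  by (simp_all add: block_def block11_def block12_def block21_def block22_def vec_eq_iff)

lemma block_eqI:
  assumes "block11 K = A" "block12 K = B" "block21 K = C" "block22 K = D"
  shows "K = block A B C D"
  using assms
  by (auto simp: block_def block11_def block12_def block21_def block22_def vec_eq_iff all_two_mode)

lemma Zmat_nth [simp]:
  "Zmat $ 1 $ 1 = 1" "Zmat $ 1 $ 2 = 0" "Zmat $ 2 $ 1 = 0" "Zmat $ 2 $ 2 = -1"
  by (simp_all add: Zmat_def)

lemma Omega_nth [simp]:
  "Omega $ 1 $ 1 = 0" "Omega $ 1 $ 2 = 1" "Omega $ 2 $ 1 = -1" "Omega $ 2 $ 2 = 0"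
  by (simp_all add: Omega_def)

lemma Omega_transpose_Omega_nth:
  fixes B :: "real^2^2"
  shows "(Omega ** transpose B ** Omega) $ 1 $ 1 = - B $ 2 $ 2"
    "(Omega ** transpose B ** Omega) $ 1 $ 2 = B $ 1 $ 2"
    "(Omega ** transpose B ** Omega) $ 2 $ 1 = B $ 2 $ 1"
    "(Omega ** transpose B ** Omega) $ 2 $ 2 = - B $ 1 $ 1"
  by (simp_all add: matrix_matrix_mult_def transpose_def sum_2)

lemma trace_transpose_self:
  fixes K :: "real^'n^'n"
  shows "trace (transpose K ** K) = (\<Sum>i\<in>UNIV. \<Sum>j\<in>UNIV. (K $ i $ j)\<^sup>2)"
  by (subst sum.swap) (simp add: trace_def matrix_matrix_mult_def transpose_def power2_eq_square)

text \<open>Tracelessness makes the second diagonal entry of \<open>block11 K\<close> and of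
  \<open>block22 K\<close> the negative of the first, hence the factors 2. The block
  \<open>block21 K\<close> repeats the squares of \<open>block12 K\<close>, which turns the weight
  1/4 into 1/2.\<close>

lemma F_Frob_sq_sp4:
  assumes "K \<in> sp4"
  shows "(F_Frob K)\<^sup>2 =
      (2 * (block11 K $ 1 $ 1)\<^sup>2 + (block11 K $ 1 $ 2)\<^sup>2 + (block11 K $ 2 $ 1)\<^sup>2 +
       2 * (block22 K $ 1 $ 1)\<^sup>2 + (block22 K $ 1 $ 2)\<^sup>2 + (block22 K $ 2 $ 1)\<^sup>2) / 4 +
      ((block12 K $ 1 $ 1)\<^sup>2 + (block12 K $ 1 $ 2)\<^sup>2 + (block12 K $ 2 $ 1)\<^sup>2 +
       (block12 K $ 2 $ 2)\<^sup>2) / 2"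
proof -
  have A: "block11 K $ 2 $ 2 = - (block11 K $ 1 $ 1)" and D: "block22 K $ 2 $ 2 = - (block22 K $ 1 $ 1)"
    and C: "block21 K = Omega ** transpose (block12 K) ** Omega"
    using assms by (auto simp: sp4_iff_blocks trace_def sum_2)
  have C': "block21 K $ 1 $ 1 = - block12 K $ 2 $ 2" "block21 K $ 1 $ 2 = block12 K $ 1 $ 2"
    "block21 K $ 2 $ 1 = block12 K $ 2 $ 1" "block21 K $ 2 $ 2 = - block12 K $ 1 $ 1"
    unfolding C by (fact Omega_transpose_Omega_nth)+
  have "(F_Frob K)\<^sup>2 = trace (transpose K ** K) / 4"
    by (simp add: F_Frob_def trace_transpose_self sum_nonneg)
  also have "trace (transpose K ** K) = (\<Sum>i\<in>UNIV. \<Sum>j\<in>UNIV. (block11 K $ i $ j)\<^sup>2 +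
      (block12 K $ i $ j)\<^sup>2 + (block21 K $ i $ j)\<^sup>2 + (block22 K $ i $ j)\<^sup>2)"
    by (simp add: trace_transpose_self sum_two_mode sum_2
        block11_def block12_def block21_def block22_def)
  finally show ?thesis
    using A D C' by (simp add: sum_2 add_divide_distrib)
qed

lemma induces_sp4_iff:
  assumes "K \<in> sp4"
  shows "induces hbar \<nu> X K \<longleftrightarrow>
      X $ 1 $ 1 = 2 * (\<nu> * block11 K $ 1 $ 1 + kappa hbar \<nu> * block12 K $ 1 $ 1) \<and>
      X $ 2 $ 2 = - 2 * (\<nu> * block11 K $ 1 $ 1 + kappa hbar \<nu> * block12 K $ 2 $ 2) \<and>
      X $ 1 $ 2 = \<nu> * (block11 K $ 1 $ 2 + block11 K $ 2 $ 1) +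
                    kappa hbar \<nu> * (block12 K $ 2 $ 1 - block12 K $ 1 $ 2) \<and>
      X $ 2 $ 1 = X $ 1 $ 2"
proof -
  have "block11 K $ 2 $ 2 = - (block11 K $ 1 $ 1)"
    using assms by (auto simp: sp4_iff_blocks trace_def sum_2)
  then show ?thesis
    by (simp add: induces_iff vec_eq_iff forall_2 matrix_matrix_mult_def transpose_def sum_2) argo
qed

section \<open>Minimizers and the minimum value\<close>

lemma frob_minimizerI:
  assumes "K \<in> sp4" "induces hbar \<nu> X K"
    and "\<And>K'. K' \<in> sp4 \<Longrightarrow> induces hbar \<nu> X K' \<Longrightarrow> (F_Frob K)\<^sup>2 \<le> (F_Frob K')\<^sup>2"
  shows "frob_minimizer hbar \<nu> X K"
  using assms by (force simp: frob_minimizer_def is_arg_min_linorder)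

text \<open>An attained minimum identifies the value behind \<open>LEAST\<close>, so each target
  only needs an explicit witness and a matching lower bound.\<close>

lemma G_Frob_eq:
  assumes "frob_minimizer hbar \<nu> X K"
  shows "G_Frob hbar \<nu> X = (F_Frob K)\<^sup>2"
  unfolding G_Frob_def
  using assms by (intro Least_equality) (auto simp: frob_minimizer_def is_arg_min_linorder)

section \<open>The gain equation and the Bures metric at \<open>Sigma_th\<close>\<close>

lemma
  assumes "hbar > 0" "\<nu> > hbar / 2"
  shows kappa_pos: "0 < kappa hbar \<nu>"
    and kappa_sq: "(kappa hbar \<nu>)\<^sup>2 = \<nu>\<^sup>2 - hbar\<^sup>2 / 4"
proof -
  have "(hbar / 2)\<^sup>2 < \<nu>\<^sup>2"
    using assms by (intro power_strict_mono) auto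
  then show "0 < kappa hbar \<nu>" "(kappa hbar \<nu>)\<^sup>2 = \<nu>\<^sup>2 - hbar\<^sup>2 / 4"
    by (auto simp: kappa_def power_divide)
qed

text \<open>The description by \<open>THE\<close> requires uniqueness. On symmetric matrices the
  gain operator acts on multiples of the identity by \<nu>^2 - hbar^2/4 and on traceless matrices by
  \<nu>^2 + hbar^2/4; both factors are positive for \<nu> > hbar/2, so the operator is
  injective.\<close>

lemma sld_gain_Sigma_th:
  assumes "hbar > 0" "\<nu> > hbar / 2" "transpose G = G"
    and "\<nu>\<^sup>2 *\<^sub>R G + (hbar\<^sup>2 / 4) *\<^sub>R (Omega ** G ** Omega) = X"
  shows "sld_gain hbar (Sigma_th \<nu>) X = G"
proof -
  have Sigma: "Sigma_th \<nu> ** H ** Sigma_th \<nu> = \<nu>\<^sup>2 *\<^sub>R H" for H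
    by (simp add: Sigma_th_def vec_eq_iff forall_2 matrix_matrix_mult_def mat_def sum_2
        power2_eq_square)
  have pos: "\<nu>\<^sup>2 - hbar\<^sup>2 / 4 > 0" "\<nu>\<^sup>2 + hbar\<^sup>2 / 4 > 0"
    using kappa_sq[OF assms(1,2)] kappa_pos[OF assms(1,2)] assms(1)
    by (metis zero_less_power, simp add: add_nonneg_pos)
  have entries: "X $ 1 $ 1 = \<nu>\<^sup>2 * M $ 1 $ 1 - hbar\<^sup>2 / 4 * M $ 2 $ 2"
    "X $ 2 $ 2 = \<nu>\<^sup>2 * M $ 2 $ 2 - hbar\<^sup>2 / 4 * M $ 1 $ 1"
    "X $ 1 $ 2 = (\<nu>\<^sup>2 + hbar\<^sup>2 / 4) * M $ 1 $ 2"
    "M $ 2 $ 1 = M $ 1 $ 2"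
    if sym: "transpose M = M"
      and eq: "\<nu>\<^sup>2 *\<^sub>R M + (hbar\<^sup>2 / 4) *\<^sub>R (Omega ** M ** Omega) = X" for M
  proof -
    \<comment> \<open>Symmetry of \<open>M\<close> removes the transpose, so the entry formulas
      apply to \<open>Omega ** M ** Omega\<close>.\<close>
    note Omega_M = Omega_transpose_Omega_nth[of M, unfolded sym]
    show "X $ 1 $ 1 = \<nu>\<^sup>2 * M $ 1 $ 1 - hbar\<^sup>2 / 4 * M $ 2 $ 2"
      "X $ 2 $ 2 = \<nu>\<^sup>2 * M $ 2 $ 2 - hbar\<^sup>2 / 4 * M $ 1 $ 1"
      "X $ 1 $ 2 = (\<nu>\<^sup>2 + hbar\<^sup>2 / 4) * M $ 1 $ 2"
      unfolding eq[symmetric] by (simp_all add: Omega_M distrib_right)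
    have "transpose M $ 1 $ 2 = M $ 1 $ 2"
      unfolding sym ..
    then show "M $ 2 $ 1 = M $ 1 $ 2"
      by (simp add: transpose_def)
  qed
  show ?thesis
    unfolding sld_gain_def Sigma
  proof (rule the_equality)
    fix H :: "real^2^2"
    assume "transpose H = H \<and> \<nu>\<^sup>2 *\<^sub>R H + (hbar\<^sup>2 / 4) *\<^sub>R (Omega ** H ** Omega) = X"
    then have H: "transpose H = H" "\<nu>\<^sup>2 *\<^sub>R H + (hbar\<^sup>2 / 4) *\<^sub>R (Omega ** H ** Omega) = X"
      by blast+
    define E where "E = H - G"
    have sym: "E $ 2 $ 1 = E $ 1 $ 2"
      using entries(4)[OF H] entries(4)[OF assms(3,4)] by (simp add: E_def)
    \<comment> \<open>Sum and difference of the diagonal entries decouple the homogeneous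
      system.\<close>
    have "(\<nu>\<^sup>2 - hbar\<^sup>2 / 4) * (E $ 1 $ 1 + E $ 2 $ 2) = 0"
      "(\<nu>\<^sup>2 + hbar\<^sup>2 / 4) * (E $ 1 $ 1 - E $ 2 $ 2) = 0"
      "(\<nu>\<^sup>2 + hbar\<^sup>2 / 4) * E $ 1 $ 2 = 0"
      using entries(1-3)[OF H] entries(1-3)[OF assms(3,4)]
      unfolding E_def vector_minus_component by argo+
    then have "E $ 1 $ 1 + E $ 2 $ 2 = 0" "E $ 1 $ 1 - E $ 2 $ 2 = 0" "E $ 1 $ 2 = 0"
      using pos by auto
    then have "E = 0"
      using sym by (simp add: vec_eq_iff forall_2)
    then show "H = G"
      by (simp add: E_def)
  qed (use assms(3,4) in auto)
qed

text \<open>On an eigenvector of conjugation by \<open>Omega\<close> the gain equation becomes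
  scalar, with solution \<open>X\<close> divided by \<nu>^2 + c hbar^2/4.\<close>

lemma g_Bures_eigen:
  assumes "hbar > 0" "\<nu> > hbar / 2" "transpose X = X" "Omega ** X ** Omega = c *\<^sub>R X"
    and "\<nu>\<^sup>2 + c * hbar\<^sup>2 / 4 \<noteq> 0"
  shows "g_Bures hbar (Sigma_th \<nu>) X Y = trace (X ** Y) / (8 * (\<nu>\<^sup>2 + c * hbar\<^sup>2 / 4))"
proof -
  define s where "s = \<nu>\<^sup>2 + c * hbar\<^sup>2 / 4"
  have s: "s \<noteq> 0"
    using assms(5) by (simp add: s_def)
  have "Omega ** ((1 / s) *\<^sub>R X) ** Omega = (1 / s) *\<^sub>R (Omega ** X ** Omega)"
    by (simp add: vec_eq_iff forall_2 matrix_matrix_mult_def sum_2)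
  then have "\<nu>\<^sup>2 *\<^sub>R ((1 / s) *\<^sub>R X) + (hbar\<^sup>2 / 4) *\<^sub>R (Omega ** ((1 / s) *\<^sub>R X) ** Omega) =
      (1 / s) *\<^sub>R (\<nu>\<^sup>2 *\<^sub>R X + (hbar\<^sup>2 / 4) *\<^sub>R (Omega ** X ** Omega))"
    by (simp add: scaleR_right_distrib mult.commute)
  also have "\<dots> = (1 / s) *\<^sub>R (s *\<^sub>R X)"
    unfolding assms(4) s_def scaleR_left_distrib by (simp add: mult.commute)
  also have "\<dots> = X"
    using s by simp
  finally have "\<nu>\<^sup>2 *\<^sub>R ((1 / s) *\<^sub>R X) + (hbar\<^sup>2 / 4) *\<^sub>R (Omega ** ((1 / s) *\<^sub>R X) ** Omega) = X" .
  moreover have "transpose ((1 / s) *\<^sub>R X) = (1 / s) *\<^sub>R X"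
    using assms(3) by (simp add: transpose_def vec_eq_iff)
  ultimately have "sld_gain hbar (Sigma_th \<nu>) X = (1 / s) *\<^sub>R X"
    using s by (intro sld_gain_Sigma_th assms(1,2)) simp_all
  then show ?thesis
    by (simp add: g_Bures_def trace_def matrix_matrix_mult_def sum_2 add_divide_distrib flip: s_def)
qed

lemma g_Bures_mat_1:
  assumes "hbar > 0" "\<nu> > hbar / 2"
  shows "g_Bures hbar (Sigma_th \<nu>) (mat 1) (mat 1) = 1 / (4 * (kappa hbar \<nu>)\<^sup>2)"
proof -
  have "\<nu>\<^sup>2 + (-1) * hbar\<^sup>2 / 4 \<noteq> 0"
    using kappa_pos[OF assms] kappa_sq[OF assms] zero_less_power[of "kappa hbar \<nu>" 2] by simp
  moreover have "Omega ** mat 1 ** Omega = (-1) *\<^sub>R mat 1"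
    by (simp add: vec_eq_iff forall_2 matrix_matrix_mult_def sum_2 mat_def)
  ultimately show ?thesis
    by (subst g_Bures_eigen[OF assms, where c = "-1"])
      (simp_all add: trace_I transpose_mat kappa_sq[OF assms] field_simps)
qed

lemma g_Bures_Zmat:
  assumes "hbar > 0" "\<nu> > hbar / 2"
  shows "g_Bures hbar (Sigma_th \<nu>) Zmat Zmat = 1 / (4 * \<nu>\<^sup>2 + hbar\<^sup>2)"
proof -
  have "\<nu>\<^sup>2 + 1 * hbar\<^sup>2 / 4 > 0"
    using assms by (simp add: add_nonneg_pos)
  moreover have "Omega ** Zmat ** Omega = 1 *\<^sub>R Zmat"
    by (simp add: vec_eq_iff forall_2 matrix_matrix_mult_def sum_2)
  moreover have "transpose Zmat = Zmat"
    by (simp add: vec_eq_iff forall_2 transpose_def)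
  ultimately show ?thesis
    by (subst g_Bures_eigen[OF assms, where c = 1])
      (simp_all add: trace_def matrix_matrix_mult_def sum_2 field_simps)
qed

section \<open>The target \<open>mat 1\<close>: minimum and unique minimizer\<close>

definition K_mat_1 :: "real \<Rightarrow> real^(2+2)^(2+2)" where
  "K_mat_1 k = block 0 ((1 / (2 * k)) *\<^sub>R Zmat) ((1 / (2 * k)) *\<^sub>R Zmat) 0"

text \<open>The two off-diagonal blocks may coincide because \<open>Omega ** Zmat ** Omega\<close>
  is \<open>Zmat\<close> itself.\<close>

lemma K_mat_1_sp4: "K_mat_1 k \<in> sp4"
  by (simp add: sp4_iff_blocks K_mat_1_def trace_def sum_2 vec_eq_iff forall_2
      Omega_transpose_Omega_nth)

lemma K_mat_1_induces:
  assumes "hbar > 0" "\<nu> > hbar / 2"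
  shows "induces hbar \<nu> (mat 1) (K_mat_1 (kappa hbar \<nu>))"
  unfolding induces_sp4_iff[OF K_mat_1_sp4]
  using kappa_pos[OF assms] by (simp add: K_mat_1_def mat_def)

lemma F_Frob_K_mat_1: "(F_Frob (K_mat_1 k))\<^sup>2 = 1 / (4 * k\<^sup>2)"
  unfolding F_Frob_sq_sp4[OF K_mat_1_sp4]
  by (simp add: K_mat_1_def power_divide power_mult_distrib)

text \<open>
  The excess cost over the minimum is \<open>(b\<^sub>1\<^sub>1 + b\<^sub>2\<^sub>2)\<^sup>2/4\<close> plus positive multiples of the squares of the remaining
  free entries, by the parallelogram identity for \<open>b\<^sub>1\<^sub>1\<close> and \<open>b\<^sub>2\<^sub>2\<close>.
\<close>

lemma F_Frob_induces_mat_1: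
  assumes "hbar > 0" "\<nu> > hbar / 2" "K \<in> sp4" "induces hbar \<nu> (mat 1) K"
  shows "1 / (4 * (kappa hbar \<nu>)\<^sup>2) \<le> (F_Frob K)\<^sup>2"
    and "(F_Frob K)\<^sup>2 = 1 / (4 * (kappa hbar \<nu>)\<^sup>2) \<Longrightarrow> K = K_mat_1 (kappa hbar \<nu>)"
proof -
  define k where "k = kappa hbar \<nu>"
  define A where "A = block11 K"
  define B where "B = block12 K"
  define D where "D = block22 K"
  have k: "k > 0"
    using kappa_pos[OF assms(1,2)] by (simp add: k_def)
  have diag: "1 = 2 * (\<nu> * A $ 1 $ 1 + k * B $ 1 $ 1)"
    "1 = - 2 * (\<nu> * A $ 1 $ 1 + k * B $ 2 $ 2)"
    using assms(4) unfolding induces_sp4_iff[OF assms(3)] A_def B_def k_def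
    by (simp_all add: mat_def)
  then have "k * (B $ 1 $ 1 - B $ 2 $ 2) = 1"
    by (simp add: algebra_simps)
  then have diff: "B $ 1 $ 1 - B $ 2 $ 2 = 1 / k"
    using k by (simp add: field_simps)
  have F: "(F_Frob K)\<^sup>2 = 1 / (4 * k\<^sup>2) + (B $ 1 $ 1 + B $ 2 $ 2)\<^sup>2 / 4 +
      ((B $ 1 $ 2)\<^sup>2 + (B $ 2 $ 1)\<^sup>2) / 2 +
      (2 * (A $ 1 $ 1)\<^sup>2 + (A $ 1 $ 2)\<^sup>2 + (A $ 2 $ 1)\<^sup>2 +
       2 * (D $ 1 $ 1)\<^sup>2 + (D $ 1 $ 2)\<^sup>2 + (D $ 2 $ 1)\<^sup>2) / 4"
  proof -
    have sq: "1 / (4 * k\<^sup>2) = (B $ 1 $ 1 - B $ 2 $ 2)\<^sup>2 / 4"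
      unfolding diff by (simp add: power_divide)
    show ?thesis
      unfolding sq F_Frob_sq_sp4[OF assms(3)] A_def[symmetric] B_def[symmetric] D_def[symmetric]
      by (simp add: power2_sum power2_diff add_divide_distrib diff_divide_distrib)
  qed
  show "1 / (4 * (kappa hbar \<nu>)\<^sup>2) \<le> (F_Frob K)\<^sup>2"
    unfolding F k_def[symmetric] by simp
  show "K = K_mat_1 (kappa hbar \<nu>)" if "(F_Frob K)\<^sup>2 = 1 / (4 * (kappa hbar \<nu>)\<^sup>2)"
  proof -
    have zero: "(B $ 1 $ 1 + B $ 2 $ 2)\<^sup>2 / 4 + ((B $ 1 $ 2)\<^sup>2 + (B $ 2 $ 1)\<^sup>2) / 2 +
      (2 * (A $ 1 $ 1)\<^sup>2 + (A $ 1 $ 2)\<^sup>2 + (A $ 2 $ 1)\<^sup>2 +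
       2 * (D $ 1 $ 1)\<^sup>2 + (D $ 1 $ 2)\<^sup>2 + (D $ 2 $ 1)\<^sup>2) / 4 = 0"
      using that unfolding F k_def[symmetric] by simp
    then have B0: "B $ 1 $ 1 + B $ 2 $ 2 = 0" "B $ 1 $ 2 = 0" "B $ 2 $ 1 = 0"
      and A0: "A $ 1 $ 1 = 0" "A $ 1 $ 2 = 0" "A $ 2 $ 1 = 0"
      and D0: "D $ 1 $ 1 = 0" "D $ 1 $ 2 = 0" "D $ 2 $ 1 = 0"
      by (simp_all add: add_nonneg_eq_0_iff)
    \<comment> \<open>The cost formula has already eliminated these two entries; tracelessness
      recovers them.\<close>
    have trace0: "A $ 2 $ 2 = 0" "D $ 2 $ 2 = 0"
      using assms(3) A0 D0 by (auto simp: sp4_iff_blocks trace_def sum_2 A_def D_def)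
    have diagB: "B $ 1 $ 1 = 1 / (2 * k)" "B $ 2 $ 2 = - (1 / (2 * k))"
      using B0(1) diff by (simp_all add: field_simps)
    have A: "A = 0" and D: "D = 0"
      using A0 D0 trace0 by (simp_all add: vec_eq_iff forall_2)
    have B: "B = (1 / (2 * k)) *\<^sub>R Zmat"
      using B0(2,3) diagB by (simp add: vec_eq_iff forall_2)
    have "block21 K = Omega ** transpose B ** Omega"
      using assms(3) by (simp add: sp4_iff_blocks B_def)
    then have "block21 K = (1 / (2 * k)) *\<^sub>R Zmat"
      unfolding B by (simp add: vec_eq_iff forall_2 Omega_transpose_Omega_nth)
    then show ?thesis
      unfolding K_mat_1_def k_def[symmetric]
      using A B D by (intro block_eqI) (simp_all add: A_def B_def D_def)
  qed
qed

text \<open>A minimizer costs no more than the witness, whose cost is the lower bound; the equality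
  case of that bound then gives uniqueness.\<close>

lemma frob_minimizer_mat_1_iff:
  assumes "hbar > 0" "\<nu> > hbar / 2"
  shows "frob_minimizer hbar \<nu> (mat 1) K \<longleftrightarrow> K = K_mat_1 (kappa hbar \<nu>)"
proof
  assume "K = K_mat_1 (kappa hbar \<nu>)"
  then show "frob_minimizer hbar \<nu> (mat 1) K"
    using F_Frob_induces_mat_1(1)[OF assms] F_Frob_K_mat_1
    by (auto intro!: frob_minimizerI K_mat_1_sp4 K_mat_1_induces assms)
next
  assume K: "frob_minimizer hbar \<nu> (mat 1) K"
  then have "K \<in> sp4" "induces hbar \<nu> (mat 1) K"
    "(F_Frob K)\<^sup>2 \<le> (F_Frob (K_mat_1 (kappa hbar \<nu>)))\<^sup>2"
    using K_mat_1_sp4 K_mat_1_induces[OF assms]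
    by (auto simp: frob_minimizer_def is_arg_min_linorder)
  then show "K = K_mat_1 (kappa hbar \<nu>)"
    using F_Frob_induces_mat_1[OF assms, of K] F_Frob_K_mat_1 by fastforce
qed

section \<open>The tangent of the purification family\<close>

lemma kappa_has_derivative:
  assumes "hbar > 0" "\<nu> > hbar / 2"
  shows "(kappa hbar has_real_derivative \<nu> / kappa hbar \<nu>) (at \<nu>)"
proof -
  have "\<nu>\<^sup>2 - hbar\<^sup>2 / 4 > 0"
    using kappa_pos[OF assms] by (simp add: kappa_def)
  then show ?thesis
    unfolding kappa_def by (auto intro!: derivative_eq_intros simp: field_simps)
qed

lemma Gamma_pur_has_derivative:
  assumes "hbar > 0" "\<nu> > hbar / 2"
  shows "(Gamma_pur hbar has_vector_derivative
      block (mat 1) ((\<nu> / kappa hbar \<nu>) *\<^sub>R Zmat) ((\<nu> / kappa hbar \<nu>) *\<^sub>R Zmat) (mat 1)) (at \<nu>)"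
proof -
  \<comment> \<open>With constant matrices split off, only the scalar coefficients are
    differentiated.\<close>
  have Gamma: "Gamma_pur hbar = (\<lambda>n. n *\<^sub>R block (mat 1) 0 0 (mat 1) +
      kappa hbar n *\<^sub>R block 0 Zmat Zmat 0)"
    by (auto simp: Gamma_pur_def block_def vec_eq_iff all_two_mode)
  have "block (mat 1) ((\<nu> / kappa hbar \<nu>) *\<^sub>R Zmat) ((\<nu> / kappa hbar \<nu>) *\<^sub>R Zmat) (mat 1) =
      block (mat 1) 0 0 (mat 1) + (\<nu> / kappa hbar \<nu>) *\<^sub>R block 0 Zmat Zmat 0"
    by (auto simp: block_def vec_eq_iff all_two_mode)
  then show ?thesis
    unfolding Gamma using kappa_has_derivative[OF assms]
    by (auto intro!: derivative_eq_intros)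
qed

text \<open>Since \<open>Zmat\<close> squares to the identity, the products contribute
  \<open>2 * k / (2 * k) = 1\<close> on the diagonal blocks and \<open>2 * \<nu> / (2 * k)\<close>
  times \<open>Zmat\<close> off the diagonal, where \<open>k\<close> is
  \<open>kappa hbar \<nu>\<close>; the latter coefficient is the derivative of
  \<open>kappa\<close>.\<close>

lemma K_mat_1_tangent:
  assumes "hbar > 0" "\<nu> > hbar / 2"
  defines "K \<equiv> K_mat_1 (kappa hbar \<nu>)"
  shows "K ** Gamma_pur hbar \<nu> + Gamma_pur hbar \<nu> ** transpose K =
      block (mat 1) ((\<nu> / kappa hbar \<nu>) *\<^sub>R Zmat) ((\<nu> / kappa hbar \<nu>) *\<^sub>R Zmat) (mat 1)"
  using kappa_pos[OF assms(1,2)]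
  by (simp add: K_def K_mat_1_def Gamma_pur_def block_def vec_eq_iff all_two_mode forall_2
      matrix_matrix_mult_def transpose_def sum_two_mode sum_2 mat_def)

section \<open>The target \<open>Zmat\<close>: minimum in the traceless sector\<close>

text \<open>The equality case of Cauchy-Schwarz: minimizing a^2/2 + p^2 subject to \<nu> a + k p =
  1/2 forces a : p = 2 \<nu> : k, and the prefactor normalizes the constraint. The minus sign in the
  lower-left block reflects \<open>Omega ** Omega = - mat 1\<close>.\<close>

definition K_Zmat :: "real \<Rightarrow> real \<Rightarrow> real^(2+2)^(2+2)" where
  "K_Zmat \<nu> k = (1 / (2 * (2 * \<nu>\<^sup>2 + k\<^sup>2))) *\<^sub>R block ((2 * \<nu>) *\<^sub>R Zmat) (k *\<^sub>R mat 1) (- k *\<^sub>R mat 1) 0"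

lemma K_Zmat_blocks:
  fixes \<nu> k :: real
  defines "l \<equiv> 1 / (2 * (2 * \<nu>\<^sup>2 + k\<^sup>2))"
  shows "block11 (K_Zmat \<nu> k) = (l * (2 * \<nu>)) *\<^sub>R Zmat" "block12 (K_Zmat \<nu> k) = (l * k) *\<^sub>R mat 1"
    "block21 (K_Zmat \<nu> k) = - (l * k) *\<^sub>R mat 1" "block22 (K_Zmat \<nu> k) = 0"
  unfolding K_Zmat_def l_def[symmetric]
  by (simp_all add: block_def block11_def block12_def block21_def block22_def vec_eq_iff)

lemma K_Zmat_sp4: "K_Zmat \<nu> k \<in> sp4"
  by (simp add: sp4_iff_blocks K_Zmat_blocks trace_def sum_2 vec_eq_iff forall_2
      Omega_transpose_Omega_nth mat_def)

lemma K_Zmat_induces: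
  assumes "hbar > 0" "\<nu> > hbar / 2"
  shows "induces hbar \<nu> Zmat (K_Zmat \<nu> (kappa hbar \<nu>))"
proof -
  have "2 * \<nu>\<^sup>2 + (kappa hbar \<nu>)\<^sup>2 > 0"
    using kappa_pos[OF assms] by (simp add: add_nonneg_pos)
  then show ?thesis
    unfolding induces_sp4_iff[OF K_Zmat_sp4]
    by (simp add: K_Zmat_blocks mat_def divide_simps) (simp add: power2_eq_square algebra_simps)
qed

lemma F_Frob_K_Zmat:
  assumes "k > 0"
  shows "(F_Frob (K_Zmat \<nu> k))\<^sup>2 = 1 / (4 * (2 * \<nu>\<^sup>2 + k\<^sup>2))"
proof -
  define s where "s = 2 * \<nu>\<^sup>2 + k\<^sup>2"
  have s: "s > 0"
    using assms by (simp add: s_def add_nonneg_pos)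
  have "(F_Frob (K_Zmat \<nu> k))\<^sup>2 = (2 * \<nu>\<^sup>2 + k\<^sup>2) / (4 * s\<^sup>2)"
    unfolding F_Frob_sq_sp4[OF K_Zmat_sp4] K_Zmat_blocks s_def
    by (simp add: mat_def power_divide power_mult_distrib add_divide_distrib
        del: distrib_left_numeral)
  also have "\<dots> = 1 / (4 * s)"
    unfolding s_def[symmetric] power2_eq_square[of s] using s by simp
  finally show ?thesis
    by (simp add: s_def)
qed

lemma F_Frob_induces_Zmat:
  assumes "hbar > 0" "\<nu> > hbar / 2" "K \<in> sp4" "induces hbar \<nu> Zmat K"
  shows "1 / (4 * (2 * \<nu>\<^sup>2 + (kappa hbar \<nu>)\<^sup>2)) \<le> (F_Frob K)\<^sup>2"
proof -
  define k where "k = kappa hbar \<nu>"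
  define a where "a = block11 K $ 1 $ 1"
  define p where "p = block12 K $ 1 $ 1"
  have k: "k > 0"
    using kappa_pos[OF assms(1,2)] by (simp add: k_def)
  have diag: "1 = 2 * (\<nu> * a + k * p)" "1 = 2 * (\<nu> * a + k * block12 K $ 2 $ 2)"
    using assms(4) unfolding induces_sp4_iff[OF assms(3)] a_def p_def k_def by simp_all
  then have "k * block12 K $ 2 $ 2 = k * p"
    unfolding distrib_left by linarith
  then have p': "block12 K $ 2 $ 2 = p"
    using k by simp
  have s: "2 * \<nu>\<^sup>2 + k\<^sup>2 > 0"
    using k by (simp add: add_nonneg_pos)
  have half: "\<nu> * a + k * p = 1 / 2"
    using diag(1) unfolding distrib_left by linarith
  have "1 = 4 * (\<nu> * a + k * p)\<^sup>2"
    unfolding half by (simp add: power_divide)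
  \<comment> \<open>Lagrange's identity for the weighted form a^2/2 + p^2; the subtracted square is
    the Cauchy-Schwarz defect.\<close>
  also have "\<dots> = 4 * (2 * \<nu>\<^sup>2 + k\<^sup>2) * (a\<^sup>2 / 2 + p\<^sup>2) - 2 * (2 * \<nu> * p - k * a)\<^sup>2"
    by (simp add: power2_eq_square algebra_simps)
  finally have "1 \<le> 4 * (2 * \<nu>\<^sup>2 + k\<^sup>2) * (a\<^sup>2 / 2 + p\<^sup>2)"
    using zero_le_power2[of "2 * \<nu> * p - k * a"] by linarith
  then have "1 / (4 * (2 * \<nu>\<^sup>2 + k\<^sup>2)) \<le> a\<^sup>2 / 2 + p\<^sup>2"
    using s by (simp add: pos_divide_le_eq mult.commute)
  \<comment> \<open>The entry \<open>a\<close> has weight 2/4, and the two equal diagonal entries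
    \<open>p\<close> have weight 1/2 each; all other terms are nonnegative.\<close>
  also have "\<dots> \<le> (F_Frob K)\<^sup>2"
    unfolding F_Frob_sq_sp4[OF assms(3)] a_def[symmetric] p_def[symmetric] p'
    by (simp add: field_simps)
  finally show ?thesis
    by (simp add: k_def)
qed

lemma frob_minimizer_K_Zmat:
  assumes "hbar > 0" "\<nu> > hbar / 2"
  shows "frob_minimizer hbar \<nu> Zmat (K_Zmat \<nu> (kappa hbar \<nu>))"
  using F_Frob_induces_Zmat[OF assms] F_Frob_K_Zmat[OF kappa_pos[OF assms]]
  by (auto intro!: frob_minimizerI K_Zmat_sp4 K_Zmat_induces assms)

theorem proposition6p2:
  fixes hbar \<nu> u :: real
  assumes "hbar > 0" and "\<nu> > hbar / 2" and "u = (2 * \<nu> / hbar)\<^sup>2"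
  shows
    "(G_Frob hbar \<nu> (mat 1) = g_Bures hbar (Sigma_th \<nu>) (mat 1) (mat 1) \<and>
      g_Bures hbar (Sigma_th \<nu>) (mat 1) (mat 1) = 1 / (hbar\<^sup>2 * (u - 1)))
   \<and> ((\<exists>!K. frob_minimizer hbar \<nu> (mat 1) K) \<and>
      (\<forall>K. frob_minimizer hbar \<nu> (mat 1) K \<longrightarrow>
         block11 K = 0 \<and>
         block12 K = (1 / (2 * kappa hbar \<nu>)) *\<^sub>R Zmat \<and>
         block21 K = Omega ** transpose (block12 K) ** Omega \<and>
         block22 K = 0 \<and>
         ((\<lambda>n. Gamma_pur hbar n) has_vector_derivative
            (K ** Gamma_pur hbar \<nu> + Gamma_pur hbar \<nu> ** transpose K)) (at \<nu>)))
   \<and> ((\<exists>K. frob_minimizer hbar \<nu> Zmat K) \<and>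
      G_Frob hbar \<nu> Zmat = 1 / (hbar\<^sup>2 * (3 * u - 1)) \<and>
      1 / (hbar\<^sup>2 * (3 * u - 1)) < 1 / (hbar\<^sup>2 * (u + 1)) \<and>
      1 / (hbar\<^sup>2 * (u + 1)) = g_Bures hbar (Sigma_th \<nu>) Zmat Zmat)"
proof -
  let ?k = "kappa hbar \<nu>" and ?K = "K_mat_1 (kappa hbar \<nu>)"
  note hyps = assms(1,2)
  have hu: "hbar\<^sup>2 * u = 4 * \<nu>\<^sup>2"
    using assms by (simp add: power_divide power_mult_distrib)
  \<comment> \<open>The denominators of the minimal costs and of the Bures values, rewritten in
    \<open>u\<close>.\<close>
  have k: "4 * ?k\<^sup>2 = hbar\<^sup>2 * (u - 1)" "4 * (2 * \<nu>\<^sup>2 + ?k\<^sup>2) = hbar\<^sup>2 * (3 * u - 1)"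
    "4 * \<nu>\<^sup>2 + hbar\<^sup>2 = hbar\<^sup>2 * (u + 1)"
    using hu by (simp_all add: kappa_sq[OF hyps] algebra_simps)
  have "hbar\<^sup>2 * (u - 1) > 0"
    using k(1) kappa_pos[OF hyps] by (metis zero_less_power zero_less_mult_iff zero_less_numeral)
  then have u: "u > 1"
    using assms(1) by (simp add: zero_less_mult_iff)
  have min_1: "frob_minimizer hbar \<nu> (mat 1) K \<longleftrightarrow> K = ?K" for K
    by (rule frob_minimizer_mat_1_iff[OF hyps])
  have "G_Frob hbar \<nu> (mat 1) = 1 / (hbar\<^sup>2 * (u - 1))"
    using G_Frob_eq[of hbar \<nu> "mat 1" ?K] min_1 F_Frob_K_mat_1[of ?k] k(1) by simp
  moreover have "g_Bures hbar (Sigma_th \<nu>) (mat 1) (mat 1) = 1 / (hbar\<^sup>2 * (u - 1))"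
    using g_Bures_mat_1[OF hyps] k(1) by simp
  moreover have "block11 ?K = 0" "block12 ?K = (1 / (2 * ?k)) *\<^sub>R Zmat" "block22 ?K = 0"
    by (simp_all add: K_mat_1_def)
  moreover have "block21 ?K = Omega ** transpose (block12 ?K) ** Omega"
    using K_mat_1_sp4[of ?k] by (simp add: sp4_iff_blocks)
  moreover have "(Gamma_pur hbar has_vector_derivative
      (?K ** Gamma_pur hbar \<nu> + Gamma_pur hbar \<nu> ** transpose ?K)) (at \<nu>)"
    unfolding K_mat_1_tangent[OF hyps] by (rule Gamma_pur_has_derivative[OF hyps])
  moreover have "G_Frob hbar \<nu> Zmat = 1 / (hbar\<^sup>2 * (3 * u - 1))"
    using G_Frob_eq[OF frob_minimizer_K_Zmat[OF hyps]] F_Frob_K_Zmat[OF kappa_pos[OF hyps]] k(2)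
    by simp
  \<comment> \<open>The gap is strict because u + 1 < 3 u - 1 amounts to u > 1.\<close>
  moreover have "1 / (hbar\<^sup>2 * (3 * u - 1)) < 1 / (hbar\<^sup>2 * (u + 1))"
    using u assms(1) by (intro divide_strict_left_mono mult_strict_left_mono mult_pos_pos) auto
  moreover have "g_Bures hbar (Sigma_th \<nu>) Zmat Zmat = 1 / (hbar\<^sup>2 * (u + 1))"
    using g_Bures_Zmat[OF hyps] k(3) by simp
  ultimately show ?thesis
    unfolding min_1 using frob_minimizer_K_Zmat[OF hyps] by auto
qed

end
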